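(* Let $\mathbf{A}=\langle A,\wedge,\vee,\cdot,{\sim},-,\neg,1\rangle$ be a quasi relation algebra and let $p\in A$ be a positive symmetric idempotent. Then $pAp$ is closed under $\wedge,\vee,\cdot,{\sim},-,\neg$, and $p\mathbf{A}p=\langle pAp,\wedge,\vee,\cdot,{\sim},-,\neg,p\rangle$ (with the operations of $\mathbf A$ restricted to $pAp$ and with $p$ as monoid identity) is a quasi relation algebra.
   Context: A quasi relation algebra (qRA) is an algebra $\mathbf A=\langle A,\wedge,\vee,\cdot,{\sim},-,\neg,1\rangle$ such that $\langle A,\wedge,\vee\rangle$ is a lattice (with order $\leqslant$), $\langle A,\cdot,1\rangle$ is a monoid (we write $ab$ for $a\cdot b$), and for all $a,b,c\in A$: (1) $ab\leqslant c$ iff $a\leqslant -(b\cdot{\sim}c)$ iff $b\leqslant {\sim}(-c\cdot a)$; (2) ${\sim}{-}a=a={-}{\sim}a$; (3) $\neg\neg a=a$; (4) $\neg(a\vee b)=\neg a\wedge\neg b$; (5) $\neg(ab)=\neg a+\neg b$, where $a+b:={\sim}(-a\cdot -b)$. An element $p$ is positive if $1\leqslant p$, symmetric if ${\sim}p=-p=\neg p$, and idempotent if $pp=p$. For $p\in A$, $pAp:=\{pap \mid a\in A\}$. *)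

theory Defs
  imports "HOL-Algebra.Group"
begin

record 'a qra = "'a monoid" +
  wedge :: "'a \<Rightarrow> 'a \<Rightarrow> 'a"  (infixl \<open>\<curlywedge>\<index>\<close> 70)
  vee   :: "'a \<Rightarrow> 'a \<Rightarrow> 'a"  (infixl \<open>\<curlyvee>\<index>\<close> 65)
  tilde :: "'a \<Rightarrow> 'a"
  dash  :: "'a \<Rightarrow> 'a"
  neg   :: "'a \<Rightarrow> 'a"

text \<open>
  The operations \<open>tilde\<close>, \<open>dash\<close> and \<open>neg\<close> are the unary operations usually written
  \<open>\<sim>\<close>, \<open>-\<close> and \<open>\<not>\<close>.
\<close>

definition qra_le :: "('a, 'm) qra_scheme \<Rightarrow> 'a \<Rightarrow> 'a \<Rightarrow> bool"  (infix \<open>\<preceq>\<index>\<close> 50)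
  where "a \<preceq>\<^bsub>A\<^esub> b \<longleftrightarrow> a \<curlywedge>\<^bsub>A\<^esub> b = a"

definition qra_plus :: "('a, 'm) qra_scheme \<Rightarrow> 'a \<Rightarrow> 'a \<Rightarrow> 'a"
  where "qra_plus A a b = tilde A (dash A a \<otimes>\<^bsub>A\<^esub> dash A b)"

locale quasi_relation_algebra = monoid A for A :: "('a, 'm) qra_scheme" (structure) +
  assumes wedge_closed: "\<lbrakk>a \<in> carrier A; b \<in> carrier A\<rbrakk> \<Longrightarrow> a \<curlywedge> b \<in> carrier A"
    and vee_closed: "\<lbrakk>a \<in> carrier A; b \<in> carrier A\<rbrakk> \<Longrightarrow> a \<curlyvee> b \<in> carrier A"
    and tilde_closed: "a \<in> carrier A \<Longrightarrow> tilde A a \<in> carrier A"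
    and dash_closed: "a \<in> carrier A \<Longrightarrow> dash A a \<in> carrier A"
    and neg_closed: "a \<in> carrier A \<Longrightarrow> neg A a \<in> carrier A"
    and wedge_assoc: "\<lbrakk>a \<in> carrier A; b \<in> carrier A; c \<in> carrier A\<rbrakk>
          \<Longrightarrow> (a \<curlywedge> b) \<curlywedge> c = a \<curlywedge> (b \<curlywedge> c)"
    and vee_assoc: "\<lbrakk>a \<in> carrier A; b \<in> carrier A; c \<in> carrier A\<rbrakk>
          \<Longrightarrow> (a \<curlyvee> b) \<curlyvee> c = a \<curlyvee> (b \<curlyvee> c)"
    and wedge_comm: "\<lbrakk>a \<in> carrier A; b \<in> carrier A\<rbrakk> \<Longrightarrow> a \<curlywedge> b = b \<curlywedge> a"
    and vee_comm: "\<lbrakk>a \<in> carrier A; b \<in> carrier A\<rbrakk> \<Longrightarrow> a \<curlyvee> b = b \<curlyvee> a"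
    and wedge_absorb: "\<lbrakk>a \<in> carrier A; b \<in> carrier A\<rbrakk> \<Longrightarrow> a \<curlywedge> (a \<curlyvee> b) = a"
    and vee_absorb: "\<lbrakk>a \<in> carrier A; b \<in> carrier A\<rbrakk> \<Longrightarrow> a \<curlyvee> (a \<curlywedge> b) = a"
    and residuation_left: "\<lbrakk>a \<in> carrier A; b \<in> carrier A; c \<in> carrier A\<rbrakk>
          \<Longrightarrow> a \<otimes> b \<preceq> c \<longleftrightarrow> a \<preceq> dash A (b \<otimes> tilde A c)"
    and residuation_right: "\<lbrakk>a \<in> carrier A; b \<in> carrier A; c \<in> carrier A\<rbrakk>
          \<Longrightarrow> a \<otimes> b \<preceq> c \<longleftrightarrow> b \<preceq> tilde A (dash A c \<otimes> a)"
    and tilde_dash: "a \<in> carrier A \<Longrightarrow> tilde A (dash A a) = a"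
    and dash_tilde: "a \<in> carrier A \<Longrightarrow> dash A (tilde A a) = a"
    and neg_neg: "a \<in> carrier A \<Longrightarrow> neg A (neg A a) = a"
    and neg_vee: "\<lbrakk>a \<in> carrier A; b \<in> carrier A\<rbrakk>
          \<Longrightarrow> neg A (a \<curlyvee> b) = neg A a \<curlywedge> neg A b"
    and neg_mult: "\<lbrakk>a \<in> carrier A; b \<in> carrier A\<rbrakk>
          \<Longrightarrow> neg A (a \<otimes> b) = qra_plus A (neg A a) (neg A b)"

definition qra_positive :: "('a, 'm) qra_scheme \<Rightarrow> 'a \<Rightarrow> bool"
  where "qra_positive A p \<longleftrightarrow> \<one>\<^bsub>A\<^esub> \<preceq>\<^bsub>A\<^esub> p"

definition qra_symmetric :: "('a, 'm) qra_scheme \<Rightarrow> 'a \<Rightarrow> bool"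
  where "qra_symmetric A p \<longleftrightarrow> tilde A p = dash A p \<and> dash A p = neg A p"

definition qra_idempotent :: "('a, 'm) qra_scheme \<Rightarrow> 'a \<Rightarrow> bool"
  where "qra_idempotent A p \<longleftrightarrow> p \<otimes>\<^bsub>A\<^esub> p = p"

definition corner_set :: "('a, 'm) qra_scheme \<Rightarrow> 'a \<Rightarrow> 'a set"
  where "corner_set A p = {p \<otimes>\<^bsub>A\<^esub> a \<otimes>\<^bsub>A\<^esub> p | a. a \<in> carrier A}"

definition corner :: "('a, 'm) qra_scheme \<Rightarrow> 'a \<Rightarrow> ('a, 'm) qra_scheme"
  where "corner A p = A\<lparr>carrier := corner_set A p, one := p\<rparr>"

end

theory Submission
  imports Defs
begin

text \<open>
  Membership in the corner \<open>pAp\<close> means \<open>pa = a = ap\<close>, and since \<open>1 \<le> p\<close> this is equivalent to the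
  inequalities \<open>pa \<le> a\<close> and \<open>ap \<le> a\<close>, which residuation handles well. Symmetry gives
  \<open>--p = p = \<sim>\<sim>p\<close>, so residuation turns \<open>a \<sim>a \<le> -p\<close> into \<open>\<sim>a \<le> \<sim>(pa)\<close>, and this yields
  \<open>\<sim>a p \<le> \<sim>a\<close>; the other one-sided conditions for \<open>\<sim>a\<close> and \<open>-a\<close> are similar. Applying \<open>\<not>\<close> to
  \<open>a = ap\<close> and \<open>a = pa\<close> shows that \<open>-\<not>a\<close> lies in the corner, hence so does \<open>\<not>a = \<sim>-\<not>a\<close>.
\<close>

context quasi_relation_algebra
begin

section \<open>Order properties of the lattice reduct\<close>

lemma le_refl: "a \<in> carrier A \<Longrightarrow> a \<preceq> a"
  using wedge_absorb[of a "a \<curlywedge> a"] vee_absorb[of a a] wedge_closed[of a a]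
  unfolding qra_le_def by metis

lemma le_trans:
  "\<lbrakk>a \<preceq> b; b \<preceq> c; a \<in> carrier A; b \<in> carrier A; c \<in> carrier A\<rbrakk> \<Longrightarrow> a \<preceq> c"
  unfolding qra_le_def using wedge_assoc[of a b c] by metis

lemma le_antisym: "\<lbrakk>a \<preceq> b; b \<preceq> a; a \<in> carrier A; b \<in> carrier A\<rbrakk> \<Longrightarrow> a = b"
  unfolding qra_le_def using wedge_comm[of a b] by metis

lemma wedge_le1: "\<lbrakk>a \<in> carrier A; b \<in> carrier A\<rbrakk> \<Longrightarrow> a \<curlywedge> b \<preceq> a"
  using wedge_assoc[of a a b] wedge_comm[of "a \<curlywedge> b" a] wedge_closed[of a b] le_refl[of a]
  unfolding qra_le_def by metis

lemma wedge_le2: "\<lbrakk>a \<in> carrier A; b \<in> carrier A\<rbrakk> \<Longrightarrow> a \<curlywedge> b \<preceq> b"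
  using wedge_le1[of b a] wedge_comm[of a b] by metis

lemma wedge_greatest:
  "\<lbrakk>c \<preceq> a; c \<preceq> b; a \<in> carrier A; b \<in> carrier A; c \<in> carrier A\<rbrakk> \<Longrightarrow> c \<preceq> a \<curlywedge> b"
  unfolding qra_le_def using wedge_assoc[of c a b] by metis

lemma vee_ge1: "\<lbrakk>a \<in> carrier A; b \<in> carrier A\<rbrakk> \<Longrightarrow> a \<preceq> a \<curlyvee> b"
  unfolding qra_le_def by (rule wedge_absorb)

lemma vee_ge2: "\<lbrakk>a \<in> carrier A; b \<in> carrier A\<rbrakk> \<Longrightarrow> b \<preceq> a \<curlyvee> b"
  using vee_ge1[of b a] vee_comm[of a b] by metis

lemma le_imp_vee_eq: "\<lbrakk>a \<preceq> b; a \<in> carrier A; b \<in> carrier A\<rbrakk> \<Longrightarrow> a \<curlyvee> b = b"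
  unfolding qra_le_def using vee_absorb[of b a] vee_comm[of a b] wedge_comm[of a b] by metis

text \<open>Absorbing \<open>b\<close> and then \<open>a\<close> into \<open>c\<close> gives
  \<open>(a \<curlyvee> b) \<curlyvee> c = c\<close>, which \<open>vee_ge1\<close> turns into the
  inequality.\<close>

lemma vee_least:
  "\<lbrakk>a \<preceq> c; b \<preceq> c; a \<in> carrier A; b \<in> carrier A; c \<in> carrier A\<rbrakk> \<Longrightarrow> a \<curlyvee> b \<preceq> c"
  using vee_ge1[of "a \<curlyvee> b" c] vee_assoc[of a b c] le_imp_vee_eq[of a c] le_imp_vee_eq[of b c]
    vee_closed[of a b] by metis

section \<open>Residuation: monotone products and antitone negations\<close>

lemma mult_left_mono:
  assumes "a \<preceq> b" "a \<in> carrier A" "b \<in> carrier A" "x \<in> carrier A"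
  shows "x \<otimes> a \<preceq> x \<otimes> b"
proof -
  \<comment> \<open>The residual \<open>?r\<close> is the largest \<open>y\<close> with
    \<open>x \<otimes> y \<preceq> x \<otimes> b\<close>, so it lies above \<open>b\<close> and
    hence above \<open>a\<close>.\<close>
  let ?r = "tilde A (dash A (x \<otimes> b) \<otimes> x)"
  have r: "?r \<in> carrier A"
    using assms by (simp add: tilde_closed dash_closed)
  have "b \<preceq> ?r"
    using residuation_right[of x b "x \<otimes> b"] assms by (simp add: le_refl)
  from le_trans[OF assms(1) this assms(2,3) r] show ?thesis
    using residuation_right[of x a "x \<otimes> b"] assms by simp
qed

lemma mult_right_mono:
  assumes "a \<preceq> b" "a \<in> carrier A" "b \<in> carrier A" "x \<in> carrier A"
  shows "a \<otimes> x \<preceq> b \<otimes> x"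
proof -
  let ?r = "dash A (x \<otimes> tilde A (b \<otimes> x))"
  have r: "?r \<in> carrier A"
    using assms by (simp add: tilde_closed dash_closed)
  have "b \<preceq> ?r"
    using residuation_left[of b x "b \<otimes> x"] assms by (simp add: le_refl)
  from le_trans[OF assms(1) this assms(2,3) r] show ?thesis
    using residuation_left[of a x "b \<otimes> x"] assms by simp
qed

lemma dash_antimono:
  assumes "a \<preceq> b" "a \<in> carrier A" "b \<in> carrier A"
  shows "dash A b \<preceq> dash A a"
proof -
  \<comment> \<open>Since \<open>tilde A (dash A \<one>) = \<one>\<close>, the element
    \<open>dash A \<one>\<close> is dualizing: residuals into it are plain negations.\<close>
  have res: "x \<otimes> y \<preceq> dash A \<one> \<longleftrightarrow> x \<preceq> dash A y" if "x \<in> carrier A" "y \<in> carrier A" for x y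
    using residuation_left[of x y "dash A \<one>"] that by (simp add: dash_closed tilde_dash)
  have "dash A b \<otimes> b \<preceq> dash A \<one>"
    using assms by (simp add: res le_refl dash_closed)
  with mult_left_mono[OF assms, of "dash A b"] have "dash A b \<otimes> a \<preceq> dash A \<one>"
    by (rule le_trans) (simp_all add: assms dash_closed)
  then show ?thesis
    using assms by (simp add: res dash_closed)
qed

text \<open>Mirror image of \<open>dash_antimono\<close>, with \<open>tilde A \<one>\<close> as the
  dualizing element.\<close>

lemma tilde_antimono:
  assumes "a \<preceq> b" "a \<in> carrier A" "b \<in> carrier A"
  shows "tilde A b \<preceq> tilde A a"
proof -
  have res: "x \<otimes> y \<preceq> tilde A \<one> \<longleftrightarrow> y \<preceq> tilde A x" if "x \<in> carrier A" "y \<in> carrier A" for x y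
    using residuation_right[of x y "tilde A \<one>"] that by (simp add: tilde_closed dash_tilde)
  have "b \<otimes> tilde A b \<preceq> tilde A \<one>"
    using assms by (simp add: res le_refl tilde_closed)
  with mult_right_mono[OF assms, of "tilde A b"] have "a \<otimes> tilde A b \<preceq> tilde A \<one>"
    by (rule le_trans) (simp_all add: assms tilde_closed)
  then show ?thesis
    using assms by (simp add: res tilde_closed)
qed

end

text \<open>Positivity, symmetry and idempotence in unfolded form; symmetry is oriented so that
  \<open>tilde A p\<close> and \<open>neg A p\<close> both rewrite to
  \<open>dash A p\<close>.\<close>

locale qra_corner = quasi_relation_algebra +
  fixes p
  assumes p_closed: "p \<in> carrier A"
    and one_le_p: "\<one> \<preceq> p"
    and tilde_p: "tilde A p = dash A p"
    and neg_p: "neg A p = dash A p"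
    and p_idem: "p \<otimes> p = p"
begin

section \<open>Membership in the corner\<close>

lemma corner_set_iff:
  "a \<in> corner_set A p \<longleftrightarrow> a \<in> carrier A \<and> p \<otimes> a = a \<and> a \<otimes> p = a"
proof
  assume "a \<in> corner_set A p"
  then obtain b where "b \<in> carrier A" "a = p \<otimes> b \<otimes> p"
    by (auto simp: corner_set_def)
  \<comment> \<open>By idempotence a further factor \<open>p\<close> on either side of
    \<open>p \<otimes> b \<otimes> p\<close> is absorbed.\<close>
  moreover have "p \<otimes> (p \<otimes> x) = p \<otimes> x" if "x \<in> carrier A" for x
    using m_assoc[of p p x] that p_closed p_idem by simp
  ultimately show "a \<in> carrier A \<and> p \<otimes> a = a \<and> a \<otimes> p = a"
    using p_closed p_idem by (simp add: m_assoc)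
next
  assume "a \<in> carrier A \<and> p \<otimes> a = a \<and> a \<otimes> p = a"
  then show "a \<in> corner_set A p"
    unfolding corner_set_def by (intro CollectI exI[of _ a]) simp
qed

lemma corner_setI:
  assumes "a \<in> carrier A" "p \<otimes> a \<preceq> a" "a \<otimes> p \<preceq> a"
  shows "a \<in> corner_set A p"
proof -
  have "a \<preceq> p \<otimes> a" "a \<preceq> a \<otimes> p"
    using assms p_closed mult_right_mono[OF one_le_p, of a] mult_left_mono[OF one_le_p, of a]
    by simp_all
  then show ?thesis
    using assms p_closed by (simp add: corner_set_iff le_antisym)
qed

lemma dash_dash_p: "dash A (dash A p) = p"
  using dash_tilde[OF p_closed] unfolding tilde_p .

lemma tilde_tilde_p: "tilde A (tilde A p) = p"
  using tilde_dash[OF p_closed] unfolding tilde_p[symmetric] .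

section \<open>Closure of the corner under the operations\<close>

lemma tilde_corner:
  assumes "a \<in> corner_set A p"
  shows "tilde A a \<in> corner_set A p"
proof (rule corner_setI)
  have a: "a \<in> carrier A" "p \<otimes> a = a" "a \<otimes> p = a"
    using assms by (simp_all add: corner_set_iff)
  note cl = a(1) p_closed tilde_closed dash_closed
  show "tilde A a \<in> carrier A"
    using cl by simp
  \<comment> \<open>Residuating in the second factor leaves
    \<open>tilde A a \<preceq> tilde A (a \<otimes> p)\<close>, an equality by
    \<open>a \<otimes> p = a\<close>.\<close>
  show "p \<otimes> tilde A a \<preceq> tilde A a"
    using residuation_right[of p "tilde A a" "tilde A a"] cl a by (simp add: dash_tilde le_refl)
  have "a \<otimes> tilde A a \<preceq> dash A p"
    using residuation_right[of a "tilde A a" "dash A p"] cl a by (simp add: dash_dash_p le_refl)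
  \<comment> \<open>Applying \<open>tilde\<close> isolates \<open>p\<close>, and residuation then
    moves one \<open>tilde A a\<close> across to the left of \<open>p\<close>.\<close>
  then have "p \<preceq> tilde A (a \<otimes> tilde A a)"
    using tilde_antimono[of "a \<otimes> tilde A a" "dash A p"] cl by (simp add: tilde_dash)
  then show "tilde A a \<otimes> p \<preceq> tilde A a"
    using residuation_right[of "tilde A a" p "tilde A a"] cl by (simp add: dash_tilde)
qed

text \<open>Mirror image of \<open>tilde_corner\<close>: left residuation replaces right
  residuation, and \<open>tilde_tilde_p\<close> replaces \<open>dash_dash_p\<close>.\<close>

lemma dash_corner:
  assumes "a \<in> corner_set A p"
  shows "dash A a \<in> corner_set A p"
proof (rule corner_setI)
  have a: "a \<in> carrier A" "p \<otimes> a = a" "a \<otimes> p = a"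
    using assms by (simp_all add: corner_set_iff)
  note cl = a(1) p_closed tilde_closed dash_closed
  show "dash A a \<in> carrier A"
    using cl by simp
  show "dash A a \<otimes> p \<preceq> dash A a"
    using residuation_left[of "dash A a" p "dash A a"] cl a by (simp add: tilde_dash le_refl)
  have "dash A a \<otimes> a \<preceq> tilde A p"
    using residuation_left[of "dash A a" a "tilde A p"] cl a by (simp add: tilde_tilde_p le_refl)
  then have "p \<preceq> dash A (dash A a \<otimes> a)"
    using dash_antimono[of "dash A a \<otimes> a" "tilde A p"] cl by (simp add: dash_tilde)
  then show "p \<otimes> dash A a \<preceq> dash A a"
    using residuation_left[of p "dash A a" "dash A a"] cl by (simp add: tilde_dash)
qed

lemma neg_corner:
  assumes "a \<in> corner_set A p"
  shows "neg A a \<in> corner_set A p"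
proof -
  have a: "a \<in> carrier A" "p \<otimes> a = a" "a \<otimes> p = a"
    using assms by (simp_all add: corner_set_iff)
  note cl = a(1) p_closed tilde_closed dash_closed neg_closed
  \<comment> \<open>De Morgan for \<open>a \<otimes> p\<close>: the second factor
    \<open>dash A (neg A p)\<close> is \<open>dash A (dash A p)\<close>, that is,
    \<open>p\<close>.\<close>
  have "neg A a = tilde A (dash A (neg A a) \<otimes> p)"
    using neg_mult[OF a(1) p_closed] unfolding a qra_plus_def neg_p dash_dash_p .
  moreover have "neg A a = tilde A (p \<otimes> dash A (neg A a))"
    using neg_mult[OF p_closed a(1)] unfolding a qra_plus_def neg_p dash_dash_p .
  \<comment> \<open>Applying \<open>dash\<close> to both equations cancels the outer
    \<open>tilde\<close>, so \<open>p\<close> fixes \<open>dash A (neg A a)\<close> on each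
    side.\<close>
  ultimately have "dash A (neg A a) \<in> corner_set A p"
    using cl by (metis corner_set_iff dash_tilde m_closed)
  then have "tilde A (dash A (neg A a)) \<in> corner_set A p"
    by (rule tilde_corner)
  then show ?thesis
    using cl by (simp add: tilde_dash)
qed

lemma wedge_corner:
  assumes "a \<in> corner_set A p" "b \<in> corner_set A p"
  shows "a \<curlywedge> b \<in> corner_set A p"
proof (rule corner_setI)
  have ab: "a \<in> carrier A" "p \<otimes> a = a" "a \<otimes> p = a" "b \<in> carrier A" "p \<otimes> b = b" "b \<otimes> p = b"
    using assms by (simp_all add: corner_set_iff)
  show cl: "a \<curlywedge> b \<in> carrier A"
    using ab wedge_closed by simp
  note le = wedge_le1[OF ab(1,4)] wedge_le2[OF ab(1,4)]
  show "p \<otimes> (a \<curlywedge> b) \<preceq> a \<curlywedge> b"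
    using mult_left_mono[OF le(1), of p] mult_left_mono[OF le(2), of p] ab cl p_closed
    by (simp add: wedge_greatest)
  show "(a \<curlywedge> b) \<otimes> p \<preceq> a \<curlywedge> b"
    using mult_right_mono[OF le(1), of p] mult_right_mono[OF le(2), of p] ab cl p_closed
    by (simp add: wedge_greatest)
qed

lemma vee_corner:
  assumes "a \<in> corner_set A p" "b \<in> corner_set A p"
  shows "a \<curlyvee> b \<in> corner_set A p"
proof (rule corner_setI)
  have ab: "a \<in> carrier A" "p \<otimes> a = a" "a \<otimes> p = a" "b \<in> carrier A" "p \<otimes> b = b" "b \<otimes> p = b"
    using assms by (simp_all add: corner_set_iff)
  show cl: "a \<curlyvee> b \<in> carrier A"
    using ab vee_closed by simp
  note closed = ab(1,4) cl p_closed tilde_closed dash_closed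
  \<comment> \<open>Monotonicity bounds products with a join only from below, so the argument uses
    residuals: \<open>p \<otimes> a = a\<close> and \<open>p \<otimes> b = b\<close> put
    \<open>a\<close> and \<open>b\<close>, hence their join, below the residual of
    \<open>a \<curlyvee> b\<close> by \<open>p\<close>.\<close>
  have "a \<curlyvee> b \<preceq> tilde A (dash A (a \<curlyvee> b) \<otimes> p)"
    using residuation_right[of p a "a \<curlyvee> b"] residuation_right[of p b "a \<curlyvee> b"] closed ab
    by (simp add: vee_ge1 vee_ge2 vee_least)
  then show "p \<otimes> (a \<curlyvee> b) \<preceq> a \<curlyvee> b"
    using residuation_right[of p "a \<curlyvee> b" "a \<curlyvee> b"] closed by simp
  have "a \<curlyvee> b \<preceq> dash A (p \<otimes> tilde A (a \<curlyvee> b))"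
    using residuation_left[of a p "a \<curlyvee> b"] residuation_left[of b p "a \<curlyvee> b"] closed ab
    by (simp add: vee_ge1 vee_ge2 vee_least)
  then show "(a \<curlyvee> b) \<otimes> p \<preceq> a \<curlyvee> b"
    using residuation_left[of "a \<curlyvee> b" p "a \<curlyvee> b"] closed by simp
qed

lemma mult_corner:
  "\<lbrakk>a \<in> corner_set A p; b \<in> corner_set A p\<rbrakk> \<Longrightarrow> a \<otimes> b \<in> corner_set A p"
  using m_assoc[of p a b] m_assoc[of a b p] p_closed by (simp add: corner_set_iff)

section \<open>The algebra on the corner\<close>

lemma corner_simps:
  "carrier (corner A p) = corner_set A p"
  "one (corner A p) = p"
  "mult (corner A p) = mult A"
  "wedge (corner A p) = wedge A"
  "vee (corner A p) = vee A"
  "tilde (corner A p) = tilde A"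
  "dash (corner A p) = dash A"
  "neg (corner A p) = neg A"
  "qra_le (corner A p) = qra_le A"
  "qra_plus (corner A p) = qra_plus A"
  \<comment> \<open>The order and the derived sum are built from operations that the corner shares
    with \<open>A\<close>, so they are unchanged.\<close>
  by (simp_all add: corner_def qra_le_def qra_plus_def fun_eq_iff)

lemma qra_corner_structure: "quasi_relation_algebra (corner A p)"
proof -
  have carrier: "a \<in> carrier A" if "a \<in> corner_set A p" for a
    using that by (simp add: corner_set_iff)
  show ?thesis
  proof (unfold_locales, unfold corner_simps)
    show "p \<in> corner_set A p"
      by (simp add: corner_set_iff p_closed p_idem)
  \<comment> \<open>Axioms without the identity are inherited from \<open>A\<close>; the reversed
    residuation laws bring both residual forms back to the product inequality. The identity laws for
    \<open>p\<close> are what \<open>corner_set_iff\<close> says.\<close>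
  qed (simp_all add: carrier mult_corner wedge_corner vee_corner tilde_corner dash_corner neg_corner
      m_assoc wedge_assoc vee_assoc wedge_absorb vee_absorb tilde_dash dash_tilde
      neg_neg neg_vee neg_mult residuation_left[symmetric] residuation_right[symmetric],
      simp_all add: corner_set_iff wedge_comm vee_comm)
qed

end

theorem theorem2:
  fixes A :: "('a, 'm) qra_scheme" (structure) and p :: 'a
  assumes "quasi_relation_algebra A"
    and "p \<in> carrier A"
    and "qra_positive A p"
    and "qra_symmetric A p"
    and "qra_idempotent A p"
  shows "(\<forall>a \<in> corner_set A p. \<forall>b \<in> corner_set A p.
            a \<curlywedge> b \<in> corner_set A p \<and> a \<curlyvee> b \<in> corner_set A p \<and> a \<otimes> b \<in> corner_set A p) \<and>
         (\<forall>a \<in> corner_set A p.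
            tilde A a \<in> corner_set A p \<and> dash A a \<in> corner_set A p \<and> neg A a \<in> corner_set A p) \<and>
         quasi_relation_algebra (corner A p)"
proof -
  interpret qra_corner A p
    using assms
    by (auto intro!: qra_corner.intro qra_corner_axioms.intro
        simp: qra_positive_def qra_symmetric_def qra_idempotent_def)
  show ?thesis
    by (simp add: wedge_corner vee_corner mult_corner tilde_corner dash_corner neg_corner
        qra_corner_structure)
qed

end
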